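(* Let $(E,\Vert\cdot\Vert)$ be a normed lattice and let $G$ be a vector lattice such that $E$ is an order dense majorizing vector sublattice of $G$. Suppose that at least one of the following conditions holds: 1. $E$ is Dedekind complete; 2. $E$ has order continuous norm. Then for every $x\in G$ the equality $$\inf\{\Vert y\Vert:\ y\in E^+,\ |x|\le y\}=\sup\{\Vert z\Vert:\ z\in E^+,\ z\le |x|\}$$ holds (that is, one may take $E^t=G$); denoting this common value by $\Vert x\Vert_t$, $(G,\Vert\cdot\Vert_t)$ is a normed lattice, and $\Vert y\Vert=\Vert y\Vert_t$ for each $y\in E$.
   Context: All vector lattices (Riesz spaces) are assumed Archimedean. A normed lattice is a vector lattice equipped with a lattice norm. $E^+$ is the set of positive elements of $E$. A vector sublattice $E$ of $G$ is majorizing in $G$ if for each $x\in G$ there is $y\in E$ with $x\le y$; it is order dense in $G$ if for each $0<x\in G$ there is $y\in E$ with $0<y\le x$. $E$ has order continuous norm if $\Vert x_\alpha\Vert\to 0$ for every decreasing net $(x_\alpha)$ in $E$ with $\inf_\alpha x_\alpha=0$. The notation $E^t$ stands for a vector sublattice of $G$ with $E\subseteq E^t\subseteq G$ every element $x$ of which satisfies the displayed equality $\inf\{\Vert y\Vert: y\in E^+, |x|\le y\}=\sup\{\Vert z\Vert: z\in E^+, z\le|x|\}$; the common value is denoted $\Vert x\Vert_t$. *)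

theory Defs
  imports Complex_Main "HOL-Library.Lattice_Algebras"
begin

class archimedean_vector_lattice = ordered_real_vector + lattice_ab_group_add_abs +
  assumes archimedean: "0 \<le> x \<Longrightarrow> 0 \<le> y \<Longrightarrow> (\<And>n::nat. real n *\<^sub>R x \<le> y) \<Longrightarrow> x = 0"

text \<open>
  The ambient vector lattice is a type of this class; a vector sublattice is a set \<open>E\<close>, with the
  induced operations and order, and a norm on it is a real-valued function of which only the values
  on \<open>E\<close> matter. A sublattice of an Archimedean vector lattice is again Archimedean.
\<close>

definition vector_sublattice :: "'a::archimedean_vector_lattice set \<Rightarrow> bool" where
  "vector_sublattice E \<longleftrightarrow>
     subspace E \<and> (\<forall>x\<in>E. \<forall>y\<in>E. sup x y \<in> E \<and> inf x y \<in> E)"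

definition majorizing :: "'a::archimedean_vector_lattice set \<Rightarrow> bool" where
  "majorizing E \<longleftrightarrow> (\<forall>x. \<exists>y\<in>E. x \<le> y)"

definition order_dense :: "'a::archimedean_vector_lattice set \<Rightarrow> bool" where
  "order_dense E \<longleftrightarrow> (\<forall>x>0. \<exists>y\<in>E. 0 < y \<and> y \<le> x)"

definition normed_lattice :: "'a::archimedean_vector_lattice set \<Rightarrow> ('a \<Rightarrow> real) \<Rightarrow> bool" where
  "normed_lattice E nrm \<longleftrightarrow>
     vector_sublattice E \<and>
     (\<forall>x\<in>E. 0 \<le> nrm x) \<and>
     (\<forall>x\<in>E. nrm x = 0 \<longleftrightarrow> x = 0) \<and>
     (\<forall>c. \<forall>x\<in>E. nrm (c *\<^sub>R x) = \<bar>c\<bar> * nrm x) \<and>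
     (\<forall>x\<in>E. \<forall>y\<in>E. nrm (x + y) \<le> nrm x + nrm y) \<and>
     (\<forall>x\<in>E. \<forall>y\<in>E. \<bar>x\<bar> \<le> \<bar>y\<bar> \<longrightarrow> nrm x \<le> nrm y)"

text \<open>Suprema and infima are taken inside \<open>E\<close>, that is, among the bounds that belong to \<open>E\<close>.\<close>

definition is_sup_in :: "'a::order set \<Rightarrow> 'a set \<Rightarrow> 'a \<Rightarrow> bool" where
  "is_sup_in E A s \<longleftrightarrow>
     s \<in> E \<and> (\<forall>a\<in>A. a \<le> s) \<and> (\<forall>u\<in>E. (\<forall>a\<in>A. a \<le> u) \<longrightarrow> s \<le> u)"

definition is_inf_in :: "'a::order set \<Rightarrow> 'a set \<Rightarrow> 'a \<Rightarrow> bool" where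
  "is_inf_in E A s \<longleftrightarrow>
     s \<in> E \<and> (\<forall>a\<in>A. s \<le> a) \<and> (\<forall>l\<in>E. (\<forall>a\<in>A. l \<le> a) \<longrightarrow> l \<le> s)"

definition dedekind_complete :: "'a::archimedean_vector_lattice set \<Rightarrow> bool" where
  "dedekind_complete E \<longleftrightarrow>
     (\<forall>A. A \<noteq> {} \<and> A \<subseteq> E \<and> (\<exists>u\<in>E. \<forall>a\<in>A. a \<le> u) \<longrightarrow> (\<exists>s. is_sup_in E A s))"

definition directed_set :: "'i set \<Rightarrow> ('i \<Rightarrow> 'i \<Rightarrow> bool) \<Rightarrow> bool" where
  "directed_set I le \<longleftrightarrow>
     I \<noteq> {} \<and>
     (\<forall>i\<in>I. le i i) \<and>
     (\<forall>i\<in>I. \<forall>j\<in>I. \<forall>k\<in>I. le i j \<and> le j k \<longrightarrow> le i k) \<and>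
     (\<forall>i\<in>I. \<forall>j\<in>I. \<exists>k\<in>I. le i k \<and> le j k)"

definition decreasing_net_in ::
  "'a::order set \<Rightarrow> 'i set \<Rightarrow> ('i \<Rightarrow> 'i \<Rightarrow> bool) \<Rightarrow> ('i \<Rightarrow> 'a) \<Rightarrow> bool" where
  "decreasing_net_in E I le x \<longleftrightarrow>
     directed_set I le \<and> (\<forall>i\<in>I. x i \<in> E) \<and> (\<forall>i\<in>I. \<forall>j\<in>I. le i j \<longrightarrow> x j \<le> x i)"

definition tails :: "'i set \<Rightarrow> ('i \<Rightarrow> 'i \<Rightarrow> bool) \<Rightarrow> 'i filter" where
  "tails I le = (INF i\<in>I. principal {j\<in>I. le i j})"

text \<open>
  HOL cannot quantify over the type of indices inside a formula, so nets are indexed by directed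
  sets of elements of the lattice itself. No generality is lost: the range of a decreasing net is
  directed downwards, and indexed by itself under the reversed order it is a decreasing net with
  the same infimum and the same limit behaviour of the norms.
\<close>

definition order_continuous_norm :: "'a::archimedean_vector_lattice set \<Rightarrow> ('a \<Rightarrow> real) \<Rightarrow> bool" where
  "order_continuous_norm E nrm \<longleftrightarrow>
     (\<forall>(I::'a set) le x. decreasing_net_in E I le x \<and> is_inf_in E (x ` I) 0 \<longrightarrow>
        ((\<lambda>i. nrm (x i)) \<longlongrightarrow> 0) (tails I le))"

definition upper_norm :: "'a::archimedean_vector_lattice set \<Rightarrow> ('a \<Rightarrow> real) \<Rightarrow> 'a \<Rightarrow> real" where
  "upper_norm E nrm x = Inf {nrm y |y. y \<in> E \<and> 0 \<le> y \<and> \<bar>x\<bar> \<le> y}"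

definition lower_norm :: "'a::archimedean_vector_lattice set \<Rightarrow> ('a \<Rightarrow> real) \<Rightarrow> 'a \<Rightarrow> real" where
  "lower_norm E nrm x = Sup {nrm z |z. z \<in> E \<and> 0 \<le> z \<and> z \<le> \<bar>x\<bar>}"

text \<open>
  The real \<open>Inf\<close> and \<open>Sup\<close> are meaningful only for nonempty sets with the relevant bound; for a
  majorizing normed sublattice this is always the case.
\<close>

lemma upper_norm_well_defined:
  assumes "normed_lattice E nrm" and "majorizing E"
  shows "{nrm y |y. y \<in> E \<and> 0 \<le> y \<and> \<bar>x\<bar> \<le> y} \<noteq> {}"
    and "bdd_below {nrm y |y. y \<in> E \<and> 0 \<le> y \<and> \<bar>x\<bar> \<le> y}"
proof -
  obtain y where "y \<in> E" "\<bar>x\<bar> \<le> y"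
    using assms(2) unfolding majorizing_def by blast
  moreover from this have "0 \<le> y"
    using abs_ge_zero order_trans by blast
  ultimately show "{nrm y |y. y \<in> E \<and> 0 \<le> y \<and> \<bar>x\<bar> \<le> y} \<noteq> {}"
    by blast
  show "bdd_below {nrm y |y. y \<in> E \<and> 0 \<le> y \<and> \<bar>x\<bar> \<le> y}"
    using assms(1) unfolding normed_lattice_def by (intro bdd_belowI[of _ 0]) blast
qed

lemma lower_norm_well_defined:
  assumes "normed_lattice E nrm" and "majorizing E"
  shows "{nrm z |z. z \<in> E \<and> 0 \<le> z \<and> z \<le> \<bar>x\<bar>} \<noteq> {}"
    and "bdd_above {nrm z |z. z \<in> E \<and> 0 \<le> z \<and> z \<le> \<bar>x\<bar>}"
proof -
  have "0 \<in> E"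
    using assms(1) unfolding normed_lattice_def vector_sublattice_def by (blast intro: subspace_0)
  then show "{nrm z |z. z \<in> E \<and> 0 \<le> z \<and> z \<le> \<bar>x\<bar>} \<noteq> {}"
    using abs_ge_zero by blast
  obtain y where y: "y \<in> E" "\<bar>x\<bar> \<le> y"
    using assms(2) unfolding majorizing_def by blast
  have "nrm z \<le> nrm y" if z: "z \<in> E" "0 \<le> z" "z \<le> \<bar>x\<bar>" for z
  proof -
    have "z \<le> y" using z(3) y(2) by (rule order_trans)
    then have "\<bar>z\<bar> \<le> \<bar>y\<bar>" using z(2) by (metis abs_of_nonneg order_trans)
    then show ?thesis using assms(1) z(1) y(1) unfolding normed_lattice_def by blast
  qed
  then show "bdd_above {nrm z |z. z \<in> E \<and> 0 \<le> z \<and> z \<le> \<bar>x\<bar>}"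
    by (intro bdd_aboveI[of _ "nrm y"]) blast
qed

end

theory Submission
  imports Defs
begin

text \<open>
  Since \<open>E\<close> is order dense and majorizing, every \<open>x \<ge> 0\<close> is both the supremum of the elements of
  \<open>E\<close> below it and the infimum of those above it. The differences \<open>y - z\<close> with \<open>z \<le> x \<le> y\<close>
  therefore decrease to \<open>0\<close>, so under either hypothesis \<open>x\<close> can be squeezed between elements of
  \<open>E\<close> whose difference has arbitrarily small norm: by order continuity, or because Dedekind
  completeness puts \<open>x\<close> itself into \<open>E\<close>.
\<close>

section \<open>Elementary rules for sublattices and lattice norms\<close>

lemma vector_sublatticeD:
  assumes "vector_sublattice E"
  shows "subspace E" "0 \<in> E"
    and "\<And>x y. x \<in> E \<Longrightarrow> y \<in> E \<Longrightarrow> x + y \<in> E"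
    and "\<And>x y. x \<in> E \<Longrightarrow> y \<in> E \<Longrightarrow> x - y \<in> E"
    and "\<And>c x. x \<in> E \<Longrightarrow> c *\<^sub>R x \<in> E"
    and "\<And>x y. x \<in> E \<Longrightarrow> y \<in> E \<Longrightarrow> sup x y \<in> E"
    and "\<And>x y. x \<in> E \<Longrightarrow> y \<in> E \<Longrightarrow> inf x y \<in> E"
    and "\<And>x. x \<in> E \<Longrightarrow> \<bar>x\<bar> \<in> E"
  using assms unfolding vector_sublattice_def
  by (auto simp: abs_lattice subspace_0 subspace_add subspace_diff subspace_scale subspace_neg)

lemma normed_latticeD:
  assumes "normed_lattice E nrm"
  shows "vector_sublattice E"
    and "\<And>x. x \<in> E \<Longrightarrow> 0 \<le> nrm x"
    and "\<And>x. x \<in> E \<Longrightarrow> nrm x = 0 \<longleftrightarrow> x = 0"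
    and "\<And>c x. x \<in> E \<Longrightarrow> nrm (c *\<^sub>R x) = \<bar>c\<bar> * nrm x"
    and "\<And>x y. x \<in> E \<Longrightarrow> y \<in> E \<Longrightarrow> nrm (x + y) \<le> nrm x + nrm y"
    and "\<And>x y. x \<in> E \<Longrightarrow> y \<in> E \<Longrightarrow> \<bar>x\<bar> \<le> \<bar>y\<bar> \<Longrightarrow> nrm x \<le> nrm y"
  using assms unfolding normed_lattice_def by blast+

lemma normed_lattice_mono:
  assumes "normed_lattice E nrm" "x \<in> E" "y \<in> E" "0 \<le> x" "x \<le> y"
  shows "nrm x \<le> nrm y"
  using assms by (intro normed_latticeD(6)) (auto intro: order_trans)

section \<open>Order approximation by elements of \<open>E\<close>\<close>

text \<open>This makes \<open>x\<close> the supremum of its minorants in \<open>E\<close> with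
  respect to the whole ambient lattice: \<open>u\<close> may lie outside \<open>E\<close>, as it
  does later for \<open>y0 - l\<close> and \<open>x - l\<close>. A failure would leave a positive
  gap \<open>x - inf u x\<close>, and a positive element of \<open>E\<close> inside that gap
  contradicts the Archimedean property.\<close>

lemma order_dense_le_upper_bound:
  assumes E: "vector_sublattice E" "order_dense E" and x: "0 \<le> x"
    and ub: "\<And>z. z \<in> E \<Longrightarrow> 0 \<le> z \<Longrightarrow> z \<le> x \<Longrightarrow> z \<le> u"
  shows "x \<le> u"
proof (rule ccontr)
  assume "\<not> x \<le> u"
  then have "inf u x \<noteq> x"
    by (metis inf.cobounded1)
  then have "inf u x < x"
    using inf.cobounded2[of u x] by (simp add: order_less_le)
  then have "0 < x - inf u x"
    by (simp only: diff_gt_0_iff_gt)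
  then obtain y where y: "y \<in> E" "0 < y" "y \<le> x - inf u x"
    using E(2) unfolding order_dense_def by blast
  \<comment> \<open>multiples of \<open>y\<close> below \<open>x\<close> are also below \<open>u\<close>, which leaves room for one more \<open>y\<close>\<close>
  have "real n *\<^sub>R y \<le> x" for n :: nat
  proof (induction n)
    case 0
    then show ?case using x by simp
  next
    case (Suc n)
    have "real n *\<^sub>R y \<le> u"
      using Suc y by (intro ub vector_sublatticeD(5)[OF E(1)]) (auto intro: scaleR_nonneg_nonneg)
    then have "real n *\<^sub>R y \<le> inf u x"
      using Suc by simp
    from add_mono[OF y(3) this] show ?case
      by (simp only: of_nat_Suc scaleR_left_distrib scaleR_one diff_add_cancel)
  qed
  then have "y = 0"
    using archimedean[of y x] x y(2) by simp
  then show False using y(2) by simp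
qed

text \<open>The reflection \<open>t\<close> to \<open>y0 - t\<close>, with \<open>y0\<close> a
  majorant of \<open>x\<close> in \<open>E\<close>, turns majorants of \<open>x\<close> into
  minorants of \<open>y0 - x\<close> and so reduces the claim to the supremum version.\<close>

lemma order_dense_ge_lower_bound:
  assumes E: "vector_sublattice E" "order_dense E" "majorizing E"
    and lb: "\<And>y. y \<in> E \<Longrightarrow> x \<le> y \<Longrightarrow> l \<le> y"
  shows "l \<le> x"
proof -
  obtain y0 where y0: "y0 \<in> E" "x \<le> y0"
    using E(3) unfolding majorizing_def by blast
  have "y0 - x \<le> y0 - l"
  proof (rule order_dense_le_upper_bound[OF E(1,2)])
    show "0 \<le> y0 - x" using y0 by simp
    fix z assume z: "z \<in> E" "0 \<le> z" "z \<le> y0 - x"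
    then have "l \<le> y0 - z"
      by (intro lb vector_sublatticeD(4)[OF E(1)] y0(1)) (auto simp: le_diff_eq add.commute)
    then show "z \<le> y0 - l" by (simp add: le_diff_eq add.commute)
  qed
  then show ?thesis by simp
qed

text \<open>Completeness gives a supremum \<open>s\<close> relative to \<open>E\<close> only, so
  \<open>s\<close> can be compared just with bounds in \<open>E\<close>. That suffices, because
  \<open>x\<close> is the infimum of its majorants in \<open>E\<close>.\<close>

lemma dedekind_complete_order_dense_mem:
  assumes E: "vector_sublattice E" "order_dense E" "majorizing E" "dedekind_complete E"
    and x: "0 \<le> x"
  shows "x \<in> E"
proof -
  let ?A = "{z \<in> E. 0 \<le> z \<and> z \<le> x}"
  obtain y where "y \<in> E" "x \<le> y"
    using E(3) unfolding majorizing_def by blast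
  then have "\<exists>u\<in>E. \<forall>a\<in>?A. a \<le> u"
    by (blast dest: order_trans)
  moreover have "?A \<noteq> {}"
    using vector_sublatticeD(2)[OF E(1)] x by blast
  ultimately obtain s where s: "is_sup_in E ?A s"
    using E(4)[unfolded dedekind_complete_def, rule_format, of ?A] by blast
  then have "x \<le> s"
    by (intro order_dense_le_upper_bound[OF E(1,2) x]) (simp add: is_sup_in_def)
  moreover have "s \<le> x"
  proof (rule order_dense_ge_lower_bound[OF E(1-3)])
    fix y assume y: "y \<in> E" "x \<le> y"
    have "\<forall>a\<in>?A. a \<le> y"
      using order_trans[OF _ y(2)] by blast
    then show "s \<le> y"
      using s y(1) unfolding is_sup_in_def by blast
  qed
  ultimately show ?thesis
    using s by (simp add: is_sup_in_def)
qed

section \<open>Gaps of small norm\<close>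

text \<open>Replaces nets by downward directed sets: \<open>D\<close> is indexed by itself under the
  reversed order.\<close>

lemma order_continuous_norm_inf_zero:
  assumes "order_continuous_norm E nrm"
    and D: "D \<subseteq> E" "D \<noteq> {}" "\<And>a b. a \<in> D \<Longrightarrow> b \<in> D \<Longrightarrow> \<exists>c\<in>D. c \<le> a \<and> c \<le> b"
    and "is_inf_in E D 0" and "0 < \<epsilon>"
  shows "\<exists>d\<in>D. nrm d < \<epsilon>"
proof -
  let ?le = "\<lambda>a b. b \<le> a"
  have "decreasing_net_in E D ?le (\<lambda>d. d)"
    using D unfolding decreasing_net_in_def directed_set_def by (auto dest: order_trans)
  then have "(nrm \<longlongrightarrow> 0) (tails D ?le)"
    using assms(1,5) unfolding order_continuous_norm_def by (simp only: image_ident)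
  then have "eventually (\<lambda>d. nrm d < \<epsilon>) (tails D ?le)"
    using \<open>0 < \<epsilon>\<close> by (rule order_tendstoD(2))
  \<comment> \<open>The tails form a filter base since \<open>D\<close> is directed, so a single
    tail already witnesses the eventual bound.\<close>
  then have "\<exists>b\<in>D. eventually (\<lambda>d. nrm d < \<epsilon>) (principal {j \<in> D. j \<le> b})"
    unfolding tails_def
  proof (subst (asm) eventually_INF_base)
    fix a b assume "a \<in> D" "b \<in> D"
    then obtain c where "c \<in> D" "c \<le> a" "c \<le> b"
      using D(3) by blast
    then show "\<exists>x\<in>D. principal {j \<in> D. j \<le> x} \<le>
        inf (principal {j \<in> D. j \<le> a}) (principal {j \<in> D. j \<le> b})"
      by (intro bexI[of _ c]) (auto dest: order_trans)
  qed (use D(2) in auto)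
  \<comment> \<open>The tail at \<open>b\<close> contains \<open>b\<close>, which is therefore the
    required element.\<close>
  then show ?thesis
    unfolding eventually_principal by blast
qed

text \<open>For a lower bound \<open>l\<close> of the gaps the two variables are eliminated in turn:
  \<open>l + z\<close> lies below every \<open>y\<close>, hence below \<open>x\<close>; then every
  \<open>z\<close> lies below \<open>x - l\<close>, hence so does \<open>x\<close>.\<close>

lemma order_dense_gaps_inf_zero:
  assumes E: "vector_sublattice E" "order_dense E" "majorizing E" and x: "0 \<le> x"
  shows "is_inf_in E {y - z |y z. y \<in> E \<and> z \<in> E \<and> 0 \<le> z \<and> z \<le> x \<and> x \<le> y} 0"
proof -
  have "l \<le> 0"
    if l: "\<And>y z. y \<in> E \<Longrightarrow> z \<in> E \<Longrightarrow> 0 \<le> z \<Longrightarrow> z \<le> x \<Longrightarrow> x \<le> y \<Longrightarrow> l \<le> y - z" for l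
  proof -
    have "x \<le> x - l"
    proof (rule order_dense_le_upper_bound[OF E(1,2) x])
      fix z assume z: "z \<in> E" "0 \<le> z" "z \<le> x"
      have "l + z \<le> x"
        by (rule order_dense_ge_lower_bound[OF E]) (use l z in \<open>auto simp: le_diff_eq\<close>)
      then show "z \<le> x - l" by (simp add: le_diff_eq add.commute)
    qed
    then show ?thesis by simp
  qed
  then show ?thesis
    unfolding is_inf_in_def using vector_sublatticeD(2)[OF E(1)]
    by (auto intro: order_trans) blast
qed

lemma order_dense_norm_squeeze:
  assumes E: "normed_lattice E nrm" "order_dense E" "majorizing E"
    "dedekind_complete E \<or> order_continuous_norm E nrm"
    and x: "0 \<le> x" and "0 < \<epsilon>"
  obtains y z where "y \<in> E" "z \<in> E" "0 \<le> z" "z \<le> x" "x \<le> y" "nrm (y - z) < \<epsilon>"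
proof -
  note V = normed_latticeD(1)[OF E(1)]
  let ?D = "{y - z |y z. y \<in> E \<and> z \<in> E \<and> 0 \<le> z \<and> z \<le> x \<and> x \<le> y}"
  have "\<exists>d\<in>?D. nrm d < \<epsilon>"
    using E(4)
  proof
    assume "dedekind_complete E"
    then have "x \<in> E"
      using dedekind_complete_order_dense_mem V E x by blast
    \<comment> \<open>Both approximants are taken to be \<open>x\<close> itself.\<close>
    then have "0 \<in> ?D"
      using x by force
    then show ?thesis
      using normed_latticeD(3)[OF E(1)] vector_sublatticeD(2)[OF V] \<open>0 < \<epsilon>\<close> by force
  next
    assume oc: "order_continuous_norm E nrm"
    show ?thesis
    proof (rule order_continuous_norm_inf_zero[OF oc])
      show "?D \<subseteq> E"
        using vector_sublatticeD(4)[OF V] by blast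
      show "?D \<noteq> {}"
        using E(3) vector_sublatticeD(2)[OF V] x unfolding majorizing_def by blast
      show "is_inf_in E ?D 0"
        by (rule order_dense_gaps_inf_zero[OF V E(2,3) x])
      fix a b assume "a \<in> ?D" "b \<in> ?D"
      then obtain y z y' z' where a: "a = y - z" "y \<in> E" "z \<in> E" "0 \<le> z" "z \<le> x" "x \<le> y"
        and b: "b = y' - z'" "y' \<in> E" "z' \<in> E" "0 \<le> z'" "z' \<le> x" "x \<le> y'"
        by blast
      \<comment> \<open>Lowering the majorant and raising the minorant shrinks both gaps at once,
        which shows that \<open>?D\<close> is directed downwards.\<close>
      have "inf y y' - sup z z' \<in> ?D"
        using a b vector_sublatticeD(6,7)[OF V]
        by (intro CollectI exI[of _ "inf y y'"] exI[of _ "sup z z'"]) (auto intro: le_supI1)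
      moreover have "inf y y' - sup z z' \<le> a" "inf y y' - sup z z' \<le> b"
        unfolding a b by (intro diff_mono; simp)+
      ultimately show "\<exists>c\<in>?D. c \<le> a \<and> c \<le> b"
        by blast
    qed fact
  qed
  then show thesis
    using that by blast
qed

section \<open>The extended norm\<close>

lemma upper_norm_le:
  assumes "normed_lattice E nrm" "majorizing E" "y \<in> E" "\<bar>x\<bar> \<le> y"
  shows "upper_norm E nrm x \<le> nrm y"
  unfolding upper_norm_def
  by (rule cInf_lower[OF _ upper_norm_well_defined(2)[OF assms(1,2)]])
    (use assms(3,4) order_trans[OF abs_ge_zero] in blast)

lemma upper_norm_greatest:
  assumes "normed_lattice E nrm" "majorizing E"
    and "\<And>y. y \<in> E \<Longrightarrow> \<bar>x\<bar> \<le> y \<Longrightarrow> c \<le> nrm y"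
  shows "c \<le> upper_norm E nrm x"
  unfolding upper_norm_def
  by (rule cInf_greatest[OF upper_norm_well_defined(1)[OF assms(1,2)]]) (use assms(3) in blast)

lemma lower_norm_ge:
  assumes "normed_lattice E nrm" "majorizing E" "z \<in> E" "0 \<le> z" "z \<le> \<bar>x\<bar>"
  shows "nrm z \<le> lower_norm E nrm x"
  unfolding lower_norm_def
  by (rule cSup_upper[OF _ lower_norm_well_defined(2)[OF assms(1,2)]]) (use assms(3-) in blast)

lemma lower_norm_le_upper_norm:
  assumes "normed_lattice E nrm" "majorizing E"
  shows "lower_norm E nrm x \<le> upper_norm E nrm x"
  unfolding lower_norm_def
proof (rule cSup_least[OF lower_norm_well_defined(1)[OF assms]])
  fix a assume "a \<in> {nrm z |z. z \<in> E \<and> 0 \<le> z \<and> z \<le> \<bar>x\<bar>}"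
  then obtain z where z: "a = nrm z" "z \<in> E" "0 \<le> z" "z \<le> \<bar>x\<bar>"
    by blast
  then show "a \<le> upper_norm E nrm x"
    using normed_lattice_mono[OF assms(1)] order_trans[OF z(4)]
    by (intro upper_norm_greatest[OF assms]) blast
qed

text \<open>With \<open>\<bar>x\<bar>\<close> squeezed between \<open>z\<close> and
  \<open>y\<close>, the triangle inequality for \<open>y = z + (y - z)\<close> keeps
  \<open>nrm y\<close> within \<epsilon> of \<open>nrm z\<close>.\<close>

lemma upper_norm_eq_lower_norm:
  assumes E: "normed_lattice E nrm" "order_dense E" "majorizing E"
    "dedekind_complete E \<or> order_continuous_norm E nrm"
  shows "upper_norm E nrm x = lower_norm E nrm x"
proof (rule antisym[OF _ lower_norm_le_upper_norm[OF E(1,3)]], rule field_le_epsilon)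
  fix \<epsilon> :: real assume "0 < \<epsilon>"
  then obtain y z where yz: "y \<in> E" "z \<in> E" "0 \<le> z" "z \<le> \<bar>x\<bar>" "\<bar>x\<bar> \<le> y" "nrm (y - z) < \<epsilon>"
    using order_dense_norm_squeeze[OF E abs_ge_zero] by blast
  have "upper_norm E nrm x \<le> nrm (z + (y - z))"
    using upper_norm_le[OF E(1,3) yz(1,5)] by simp
  also have "\<dots> \<le> nrm z + nrm (y - z)"
    using yz(1,2) normed_latticeD(1,5)[OF E(1)] vector_sublatticeD(4) by blast
  also have "\<dots> \<le> lower_norm E nrm x + \<epsilon>"
    using lower_norm_ge[OF E(1,3) yz(2-4)] yz(6) by simp
  finally show "upper_norm E nrm x \<le> lower_norm E nrm x + \<epsilon>" .
qed

text \<open>The infimum is attained at \<open>\<bar>y\<bar>\<close>, which is itself an element of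
  \<open>E\<close>.\<close>

lemma upper_norm_extends:
  assumes E: "normed_lattice E nrm" "majorizing E" and y: "y \<in> E"
  shows "upper_norm E nrm y = nrm y"
proof (rule antisym)
  note V = normed_latticeD(1)[OF E(1)]
  have "nrm \<bar>y\<bar> \<le> nrm y"
    using y vector_sublatticeD(8)[OF V] by (intro normed_latticeD(6)[OF E(1)]) auto
  then show "upper_norm E nrm y \<le> nrm y"
    using upper_norm_le[OF E, of "\<bar>y\<bar>" y] y vector_sublatticeD(8)[OF V] by fastforce
  show "nrm y \<le> upper_norm E nrm y"
    using y by (intro upper_norm_greatest[OF E] normed_latticeD(6)[OF E(1)])
      (auto intro: order_trans[OF _ abs_ge_self])
qed

lemma upper_norm_nonneg:
  assumes E: "normed_lattice E nrm" "majorizing E"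
  shows "0 \<le> upper_norm E nrm x"
  by (intro upper_norm_greatest[OF E] normed_latticeD(2)[OF E(1)])

lemma abs_scaleR_le:
  fixes x y :: "'a::archimedean_vector_lattice"
  assumes "\<bar>x\<bar> \<le> y"
  shows "\<bar>c *\<^sub>R x\<bar> \<le> \<bar>c\<bar> *\<^sub>R y"
proof (rule abs_leI)
  have "\<bar>c\<bar> *\<^sub>R x \<le> \<bar>c\<bar> *\<^sub>R y" "\<bar>c\<bar> *\<^sub>R (- x) \<le> \<bar>c\<bar> *\<^sub>R y"
    using assms abs_le_D1 abs_le_D2 by (blast intro: scaleR_left_mono abs_ge_zero)+
  then show "c *\<^sub>R x \<le> \<bar>c\<bar> *\<^sub>R y" "- (c *\<^sub>R x) \<le> \<bar>c\<bar> *\<^sub>R y"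
    by (cases "0 \<le> c"; simp)+
qed

text \<open>Scaling majorants gives one inequality for nonzero scalars; the other is the same
  inequality for \<open>inverse c\<close> and \<open>c *\<^sub>R x\<close>. For \<open>c = 0\<close>
  the value is that of \<open>nrm\<close> at \<open>0\<close>.\<close>

lemma upper_norm_scaleR:
  assumes E: "normed_lattice E nrm" "majorizing E"
  shows "upper_norm E nrm (c *\<^sub>R x) = \<bar>c\<bar> * upper_norm E nrm x"
proof (cases "c = 0")
  case True
  then show ?thesis
    using upper_norm_extends[OF E] normed_latticeD(1,3)[OF E(1)] vector_sublatticeD(2) by fastforce
next
  case False
  have le: "upper_norm E nrm (c *\<^sub>R x) \<le> \<bar>c\<bar> * upper_norm E nrm x" if "c \<noteq> 0" for c x
  proof -
    have "upper_norm E nrm (c *\<^sub>R x) / \<bar>c\<bar> \<le> upper_norm E nrm x"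
    proof (rule upper_norm_greatest[OF E])
      fix y assume y: "y \<in> E" "\<bar>x\<bar> \<le> y"
      have "upper_norm E nrm (c *\<^sub>R x) \<le> nrm (\<bar>c\<bar> *\<^sub>R y)"
        using y by (intro upper_norm_le[OF E] abs_scaleR_le
            vector_sublatticeD(5)[OF normed_latticeD(1)[OF E(1)]])
      also have "\<dots> = \<bar>c\<bar> * nrm y"
        using normed_latticeD(4)[OF E(1) y(1)] by simp
      finally show "upper_norm E nrm (c *\<^sub>R x) / \<bar>c\<bar> \<le> nrm y"
        using that by (simp add: field_simps)
    qed
    then show ?thesis
      using that by (simp add: field_simps)
  qed
  have "upper_norm E nrm x \<le> \<bar>inverse c\<bar> * upper_norm E nrm (c *\<^sub>R x)"
    using le[of "inverse c" "c *\<^sub>R x"] False by simp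
  then have "\<bar>c\<bar> * upper_norm E nrm x \<le> upper_norm E nrm (c *\<^sub>R x)"
    using False by (simp add: field_simps)
  then show ?thesis
    using le[OF False, of x] by simp
qed

lemma upper_norm_triangle:
  assumes E: "normed_lattice E nrm" "majorizing E"
  shows "upper_norm E nrm (x + y) \<le> upper_norm E nrm x + upper_norm E nrm y"
proof -
  \<comment> \<open>Moving one term across leaves a single infimum on the right, so the majorants
    \<open>u\<close> and \<open>v\<close> can be introduced one after the other.\<close>
  have "upper_norm E nrm (x + y) - upper_norm E nrm y \<le> upper_norm E nrm x"
  proof (rule upper_norm_greatest[OF E])
    fix u assume u: "u \<in> E" "\<bar>x\<bar> \<le> u"
    have "upper_norm E nrm (x + y) - nrm u \<le> upper_norm E nrm y"
    proof (rule upper_norm_greatest[OF E])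
      fix v assume v: "v \<in> E" "\<bar>y\<bar> \<le> v"
      have "\<bar>x + y\<bar> \<le> u + v"
        using abs_triangle_ineq add_mono[OF u(2) v(2)] by (rule order_trans)
      then have "upper_norm E nrm (x + y) \<le> nrm (u + v)"
        using u v by (intro upper_norm_le[OF E]
            vector_sublatticeD(3)[OF normed_latticeD(1)[OF E(1)]])
      also have "\<dots> \<le> nrm u + nrm v"
        using u v by (intro normed_latticeD(5)[OF E(1)])
      finally show "upper_norm E nrm (x + y) - nrm u \<le> nrm v"
        by simp
    qed
    then show "upper_norm E nrm (x + y) - upper_norm E nrm y \<le> nrm u"
      by simp
  qed
  then show ?thesis by simp
qed

lemma upper_norm_mono:
  assumes E: "normed_lattice E nrm" "majorizing E" and "\<bar>x\<bar> \<le> \<bar>y\<bar>"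
  shows "upper_norm E nrm x \<le> upper_norm E nrm y"
  by (intro upper_norm_greatest[OF E] upper_norm_le[OF E])
    (auto intro: order_trans[OF assms(3)])

text \<open>Definiteness is visible from the supremum side: order density puts a nonzero element of
  \<open>E\<close> below \<open>\<bar>x\<bar>\<close>.\<close>

lemma lower_norm_pos:
  assumes E: "normed_lattice E nrm" "order_dense E" "majorizing E" and "x \<noteq> 0"
  shows "0 < lower_norm E nrm x"
proof -
  obtain z where z: "z \<in> E" "0 < z" "z \<le> \<bar>x\<bar>"
    using E(2) \<open>x \<noteq> 0\<close> unfolding order_dense_def by (metis zero_less_abs_iff)
  then have "0 < nrm z"
    using normed_latticeD(2,3)[OF E(1) z(1)] by (auto simp: order_less_le)
  also have "\<dots> \<le> lower_norm E nrm x"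
    using z by (intro lower_norm_ge[OF E(1,3)]) auto
  finally show ?thesis .
qed

theorem theorem2:
  fixes E :: "'a::archimedean_vector_lattice set" and nrm :: "'a \<Rightarrow> real"
  assumes "normed_lattice E nrm"
    and "order_dense E"
    and "majorizing E"
    and "dedekind_complete E \<or> order_continuous_norm E nrm"
  shows "(\<forall>x. upper_norm E nrm x = lower_norm E nrm x) \<and>
         normed_lattice UNIV (upper_norm E nrm) \<and>
         (\<forall>y\<in>E. nrm y = upper_norm E nrm y)"
proof (intro conjI allI ballI)
  note eq = upper_norm_eq_lower_norm[OF assms]
  show "upper_norm E nrm x = lower_norm E nrm x" for x
    by (rule eq)
  show "nrm y = upper_norm E nrm y" if "y \<in> E" for y
    using upper_norm_extends[OF assms(1,3) that] by simp
  \<comment> \<open>Positivity is transferred from the lower norm by \<open>eq\<close>; the value at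
    \<open>0\<close> is homogeneity with scalar \<open>0\<close>.\<close>
  have "upper_norm E nrm x = 0 \<longleftrightarrow> x = 0" for x
    using lower_norm_pos[OF assms(1-3), of x] upper_norm_scaleR[OF assms(1,3), of 0 x]
    by (cases "x = 0") (auto simp: eq)
  then show "normed_lattice UNIV (upper_norm E nrm)"
    unfolding normed_lattice_def vector_sublattice_def
    using upper_norm_nonneg[OF assms(1,3)] upper_norm_scaleR[OF assms(1,3)]
      upper_norm_triangle[OF assms(1,3)] upper_norm_mono[OF assms(1,3)]
    by (auto simp: subspace_UNIV)
qed

end
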